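(* Let $X=\{x_1,\dots,x_n\}$ be a finite metric space of negative type, with metric $d$, and suppose $X$ admits a microscopic weighting $\widehat{\mathbf{w}}=(\widehat w_1,\dots,\widehat w_n)^{\mathrm T}$. Let $\mathbf{y}_1,\dots,\mathbf{y}_n\in\mathbb{R}^{n-1}$ be any points such that $\|\mathbf{y}_i-\mathbf{y}_j\|^2=d(x_i,x_j)$ for all $i,j$ (i.e. the vertices of any embedding of the Schoenberg polytope $\Delta(X)$ into $\mathbb{R}^{n-1}$). Then $\mathbf{y}_1,\dots,\mathbf{y}_n$ lie on the sphere centered at the point $$\mathbf{p}=\sum_{i=1}^n\widehat w_i\,\mathbf{y}_i$$ whose radius is $r=\sqrt{\tfrac12\mu_X'(0)}$.
   Context: For a finite metric space $X=\{x_1,\dots,x_n\}$ with metric $d$, let $D=(d(x_i,x_j))_{i,j}$ be the distance matrix and, for $t>0$, $Z(t)=(e^{-t d(x_i,x_j)})_{i,j}$. Write $\mathbf{1}=(1,\dots,1)^{\mathrm T}\in\mathbb{R}^n$. For all sufficiently small $t>0$, $Z(t)$ is invertible; put $\mathbf{w}(t)=Z(t)^{-1}\mathbf{1}$, and let $\mu_X(t)=\mathbf{1}^{\mathrm T}\mathbf{w}(t)$ (the magnitude function). $X$ admits a microscopic weighting if $\widehat{\mathbf{w}}:=\lim_{t\to0^+}\mathbf{w}(t)$ exists componentwise in $\mathbb{R}^n$; then $\widehat{\mathbf{w}}$ is the microscopic weighting. In that case $\mu_X$, extended by $\mu_X(0)=\lim_{t\to0^+}\mu_X(t)=1$, is (one-sidedly)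 differentiable at $0$, and $\mu_X'(0)$ denotes the derivative. $X$ is of negative type if $\mathbf{u}^{\mathrm T}D\mathbf{u}\le0$ for every $\mathbf{u}\in\mathbb{R}^n$ with $\mathbf{1}^{\mathrm T}\mathbf{u}=0$. By a theorem of Schoenberg, for $X$ of negative type there exist points $\mathbf{y}_1,\dots,\mathbf{y}_n\in\mathbb{R}^{n-1}$ with $\|\mathbf{y}_i-\mathbf{y}_j\|^2=d(x_i,x_j)$; the Schoenberg polytope $\Delta(X)$ is their convex hull, defined up to Euclidean isometry. *)

theory Defs
  imports "HOL-Analysis.Analysis"
begin

text \<open>A finite metric space is given by a carrier \<open>X\<close> and metric \<open>d\<close> with \<open>Metric_space X d\<close>,
  together with an enumeration \<open>x\<close> of \<open>X\<close> by a finite index type; the functions below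
  take \<open>d\<close> and \<open>x\<close>. The all-ones vector is \<open>vec 1\<close>.\<close>

definition distance_matrix :: "('a \<Rightarrow> 'a \<Rightarrow> real) \<Rightarrow> ('n::finite \<Rightarrow> 'a) \<Rightarrow> real ^ 'n ^ 'n" where
  "distance_matrix d x = (\<chi> i j. d (x i) (x j))"

definition similarity_matrix ::
  "('a \<Rightarrow> 'a \<Rightarrow> real) \<Rightarrow> ('n::finite \<Rightarrow> 'a) \<Rightarrow> real \<Rightarrow> real ^ 'n ^ 'n" where
  "similarity_matrix d x t = (\<chi> i j. exp (- t * d (x i) (x j)))"

text \<open>Meaningful only where the similarity matrix is invertible, as it is for all
  sufficiently small \<open>t > 0\<close>.\<close>

definition weighting :: "('a \<Rightarrow> 'a \<Rightarrow> real) \<Rightarrow> ('n::finite \<Rightarrow> 'a) \<Rightarrow> real \<Rightarrow> real ^ 'n" where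
  "weighting d x t = matrix_inv (similarity_matrix d x t) *v vec 1"

definition is_microscopic_weighting ::
  "('a \<Rightarrow> 'a \<Rightarrow> real) \<Rightarrow> ('n::finite \<Rightarrow> 'a) \<Rightarrow> real ^ 'n \<Rightarrow> bool" where
  "is_microscopic_weighting d x w \<longleftrightarrow>
     (\<forall>i. ((\<lambda>t. weighting d x t $ i) \<longlongrightarrow> w $ i) (at_right 0))"

definition magnitude :: "('a \<Rightarrow> 'a \<Rightarrow> real) \<Rightarrow> ('n::finite \<Rightarrow> 'a) \<Rightarrow> real \<Rightarrow> real" where
  "magnitude d x t = vec 1 \<bullet> weighting d x t"

text \<open>The similarity matrix at \<open>0\<close> is the all-ones matrix, so the value there is
  defined as the one-sided limit (which is \<open>1\<close> if there is a microscopic weighting).\<close>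

definition magnitude_function :: "('a \<Rightarrow> 'a \<Rightarrow> real) \<Rightarrow> ('n::finite \<Rightarrow> 'a) \<Rightarrow> real \<Rightarrow> real" where
  "magnitude_function d x t = (if t = 0 then Lim (at_right 0) (magnitude d x) else magnitude d x t)"

definition negative_type :: "('a \<Rightarrow> 'a \<Rightarrow> real) \<Rightarrow> ('n::finite \<Rightarrow> 'a) \<Rightarrow> bool" where
  "negative_type d x \<longleftrightarrow>
     (\<forall>u :: real ^ 'n. vec 1 \<bullet> u = 0 \<longrightarrow> u \<bullet> (distance_matrix d x *v u) \<le> 0)"

text \<open>In the theorem stated over these definitions, \<open>\<real>\<close> to the power \<open>n - 1\<close> is rendered as
  an \<open>(n - 1)\<close>-dimensional linear subspace \<open>S\<close> of a Euclidean space: class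
  \<open>euclidean_space\<close> has no zero-dimensional instance, so a type of dimension \<open>n - 1\<close>
  would exclude the one-point space.\<close>

end

theory Submission
  imports Defs "HOL-Complex_Analysis.Complex_Singularities" "HOL-Real_Asymp.Real_Asymp"
begin

text \<open>The determinant of \<open>Z(t)\<close> is an exponential sum tending to \<open>1\<close> as \<open>t\<close> grows, so its zeros are
  isolated and \<open>Z(t) w(t) = 1\<close> for small \<open>t > 0\<close>. Each row of this equation reads
  \<open>(\<mu>(t) - 1) / t = \<Sum>\<^sub>j (1 - exp (- t d\<^sub>i\<^sub>j)) / t w\<^sub>j(t)\<close>, and the right-hand side tends to
  \<open>(D w)\<^sub>i\<close>. Hence \<open>\<mu>'(0)\<close> exists and \<open>D w\<close> is the constant vector with this entry. As the weights
  sum to \<open>1\<close>, the parallel axis identity turns that into the equality of all distances to \<open>p\<close>.\<close>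

text \<open>Off-diagonal entries decay as \<open>t\<close> grows, so the matrix tends to
  \<open>mat 1\<close>. This gives the one nonzero value that excludes a determinant vanishing
  identically.\<close>

lemma ex_det_similarity_matrix_nonzero:
  fixes x :: "'n::finite \<Rightarrow> 'a"
  assumes "\<And>i. d (x i) (x i) = 0" and "\<And>i j. i \<noteq> j \<Longrightarrow> d (x i) (x j) > 0"
  shows "\<exists>t. det (similarity_matrix d x t) \<noteq> 0"
proof -
  have entry: "((\<lambda>t. similarity_matrix d x t $ i $ j) \<longlongrightarrow> mat 1 $ i $ j) at_top" for i j
  proof (cases "i = j")
    case True
    then show ?thesis using assms(1) by (simp add: similarity_matrix_def mat_def)
  next
    case False
    have "((\<lambda>t. exp (- (d (x i) (x j) * t))) \<longlongrightarrow> 0) at_top"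
      using assms(2)[OF False] by real_asymp
    then show ?thesis using False by (simp add: similarity_matrix_def mat_def mult.commute)
  qed
  have "((\<lambda>t. det (similarity_matrix d x t)) \<longlongrightarrow> det (mat 1 :: real^'n^'n)) at_top"
    unfolding det_def by (intro tendsto_intros entry)
  then have "\<forall>\<^sub>F t in at_top. det (similarity_matrix d x t) > 0"
    by (intro order_tendstoD(1)) auto
  then show ?thesis
    by (metis eventually_at_top_linorder less_irrefl order_refl)
qed

lemma eventually_invertible_similarity_matrix:
  fixes x :: "'n::finite \<Rightarrow> 'a"
  assumes "\<And>i. d (x i) (x i) = 0" and "\<And>i j. i \<noteq> j \<Longrightarrow> d (x i) (x j) > 0"
  shows "\<forall>\<^sub>F t in at_right 0. invertible (similarity_matrix d x t)"
proof -
  \<comment> \<open>The Leibniz expansion of the determinant with \<open>t\<close> made complex: an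
    entire function, so the identity theorem applies.\<close>
  define f :: "complex \<Rightarrow> complex" where
    "f z = (\<Sum>p | p permutes (UNIV :: 'n set). of_int (sign p) *
      (\<Prod>i\<in>UNIV. exp (- z * of_real (d (x i) (x (p i))))))" for z
  have f_real: "f (of_real t) = of_real (det (similarity_matrix d x t))" for t
    unfolding f_def det_def similarity_matrix_def by (simp flip: exp_of_real)
  have hol: "f holomorphic_on UNIV"
    unfolding f_def by (intro holomorphic_intros)
  obtain t0 where t0: "det (similarity_matrix d x t0) \<noteq> 0"
    using ex_det_similarity_matrix_nonzero[of d x] assms by blast
  \<comment> \<open>\<open>f\<close> may vanish at \<open>0\<close> itself, where all entries are
    \<open>1\<close>; being nonzero at \<open>t0\<close>, it has no other zeros near
    \<open>0\<close>.\<close>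
  have "\<forall>\<^sub>F z in at 0. f z \<noteq> 0"
    using non_zero_neighbour_alt[OF hol, of 0 "of_real t0"] t0 by (auto simp: f_real elim: eventually_mono)
  moreover have "filterlim of_real (at (0::complex)) (at_right (0::real))"
    by (auto simp: filterlim_at eventually_at_filter intro!: tendsto_eq_intros)
  ultimately have "\<forall>\<^sub>F t in at_right (0::real). f (of_real t) \<noteq> 0"
    by (rule eventually_compose_filterlim)
  then show ?thesis
    by (simp add: f_real invertible_det_nz)
qed

lemma matrix_mult_matrix_inv:
  assumes "invertible A"
  shows "A ** matrix_inv A = mat 1"
  using someI_ex[OF assms[unfolded invertible_def]] by (simp add: matrix_inv_def)

lemma similarity_matrix_mult_weighting:
  assumes "invertible (similarity_matrix d x t)"
  shows "similarity_matrix d x t *v weighting d x t = vec 1"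
  using assms
  by (simp add: weighting_def matrix_vector_mul_assoc matrix_mult_matrix_inv)

text \<open>Row \<open>i\<close> of the weighting equation is subtracted from the sum of the
  weights. The left-hand side does not involve \<open>i\<close>, so every row yields the same
  quotient.\<close>

lemma magnitude_difference_quotient:
  assumes "invertible (similarity_matrix d x t)" and "t \<noteq> 0"
  shows "(magnitude d x t - 1) / t =
    (\<Sum>j\<in>UNIV. (1 - exp (- t * d (x i) (x j))) / t * weighting d x t $ j)"
proof -
  have "(\<Sum>j\<in>UNIV. exp (- t * d (x i) (x j)) * weighting d x t $ j) = 1"
    using similarity_matrix_mult_weighting[OF assms(1)]
    by (simp add: vec_eq_iff matrix_vector_mult_def similarity_matrix_def)
  then have "magnitude d x t - 1 =
      (\<Sum>j\<in>UNIV. (1 - exp (- t * d (x i) (x j))) * weighting d x t $ j)"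
    by (simp add: magnitude_def inner_vec_def algebra_simps sum_subtractf)
  then show ?thesis
    by (simp add: sum_divide_distrib)
qed

lemma microscopic_weighting_sum:
  assumes "is_microscopic_weighting d x w"
    and inv: "\<forall>\<^sub>F t in at_right 0. invertible (similarity_matrix d x t)"
  shows "(\<Sum>j\<in>UNIV. w $ j) = 1"
proof -
  \<comment> \<open>Any single row suffices: its exponential coefficients all tend to
    \<open>1\<close>.\<close>
  fix i
  have lim: "((\<lambda>t. weighting d x t $ j) \<longlongrightarrow> w $ j) (at_right 0)" for j
    using assms(1) by (simp add: is_microscopic_weighting_def)
  have "((\<lambda>t. \<Sum>j\<in>UNIV. exp (- t * d (x i) (x j)) * weighting d x t $ j) \<longlongrightarrow>
      (\<Sum>j\<in>UNIV. exp (- 0 * d (x i) (x j)) * w $ j)) (at_right 0)"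
    by (intro tendsto_intros lim)
  moreover have "\<forall>\<^sub>F t in at_right 0.
      (\<Sum>j\<in>UNIV. exp (- t * d (x i) (x j)) * weighting d x t $ j) = 1"
    using inv
  proof eventually_elim
    case (elim t)
    then show ?case
      using similarity_matrix_mult_weighting[OF elim]
      by (simp add: vec_eq_iff matrix_vector_mult_def similarity_matrix_def)
  qed
  ultimately show ?thesis
    using tendsto_unique[OF trivial_limit_at_right_real _ tendsto_eventually] by fastforce
qed

lemma magnitude_tendsto:
  assumes "is_microscopic_weighting d x w"
  shows "(magnitude d x \<longlongrightarrow> (\<Sum>j\<in>UNIV. w $ j)) (at_right 0)"
  using assms unfolding magnitude_def is_microscopic_weighting_def inner_vec_def
  by (simp add: tendsto_sum)

lemma at_0_within_atLeast: "at 0 within {0..} = at_right (0::real)"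
  unfolding at_within_def by (intro arg_cong2[where f = inf] arg_cong[where f = principal]) auto

lemma magnitude_function_has_derivative_0:
  assumes w: "is_microscopic_weighting d x w"
    and inv: "\<forall>\<^sub>F t in at_right 0. invertible (similarity_matrix d x t)"
  shows "(magnitude_function d x has_real_derivative (\<Sum>j\<in>UNIV. d (x i) (x j) * w $ j))
    (at 0 within {0..})"
proof -
  have lim: "((\<lambda>t. weighting d x t $ j) \<longlongrightarrow> w $ j) (at_right 0)" for j
    using w by (simp add: is_microscopic_weighting_def)
  have quotient: "((\<lambda>t. (1 - exp (- t * a)) / t) \<longlongrightarrow> a) (at_right 0)" for a :: real
    by real_asymp
  have at_0: "magnitude_function d x 0 = 1"
    using tendsto_Lim[OF trivial_limit_at_right_real magnitude_tendsto[OF w]]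
    by (simp add: magnitude_function_def microscopic_weighting_sum[OF assms])
  have "((\<lambda>t. \<Sum>j\<in>UNIV. (1 - exp (- t * d (x i) (x j))) / t * weighting d x t $ j) \<longlongrightarrow>
      (\<Sum>j\<in>UNIV. d (x i) (x j) * w $ j)) (at_right 0)"
    by (intro tendsto_sum tendsto_mult lim quotient)
  moreover have "\<forall>\<^sub>F t in at_right 0.
      (\<Sum>j\<in>UNIV. (1 - exp (- t * d (x i) (x j))) / t * weighting d x t $ j) =
      (magnitude_function d x t - magnitude_function d x 0) / (t - 0)"
    using inv eventually_at_right_less
  proof eventually_elim
    case (elim t)
    \<comment> \<open>The value at \<open>0\<close> is replaced by \<open>1\<close> first; unfolding
      the definition there would expose \<open>Lim\<close> instead.\<close>
    then show ?case
      using magnitude_difference_quotient[OF elim(1), of i]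
      by (simp add: at_0) (simp add: magnitude_function_def)
  qed
  ultimately have "((\<lambda>t. (magnitude_function d x t - magnitude_function d x 0) / (t - 0)) \<longlongrightarrow>
      (\<Sum>j\<in>UNIV. d (x i) (x j) * w $ j)) (at_right 0)"
    by (rule Lim_transform_eventually)
  then show ?thesis
    by (simp add: has_field_derivative_iff at_0_within_atLeast)
qed

text \<open>Expanding each square about \<open>p\<close> leaves a cross term that vanishes because
  \<open>p\<close> is the weighted mean. The weights may be negative.\<close>

lemma parallel_axis:
  fixes y :: "'i \<Rightarrow> 'b::real_inner"
  assumes "(\<Sum>j\<in>A. w j) = 1" and p: "p = (\<Sum>j\<in>A. w j *\<^sub>R y j)"
  shows "(\<Sum>j\<in>A. w j * (norm (z - y j))\<^sup>2) =
    (norm (z - p))\<^sup>2 + (\<Sum>j\<in>A. w j * (norm (y j - p))\<^sup>2)"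
proof -
  have "(norm (z - y j))\<^sup>2 = (norm (z - p))\<^sup>2 - 2 * ((z - p) \<bullet> (y j - p)) + (norm (y j - p))\<^sup>2" for j
    by (simp add: power2_norm_eq_inner algebra_simps inner_commute)
  then have "(\<Sum>j\<in>A. w j * (norm (z - y j))\<^sup>2) =
      (\<Sum>j\<in>A. w j) * (norm (z - p))\<^sup>2 - 2 * ((z - p) \<bullet> (\<Sum>j\<in>A. w j *\<^sub>R (y j - p)))
      + (\<Sum>j\<in>A. w j * (norm (y j - p))\<^sup>2)"
    by (simp add: inner_sum_right sum_distrib_left sum_distrib_right sum.distrib sum_subtractf
        distrib_left right_diff_distrib mult.left_commute)
  moreover have "(\<Sum>j\<in>A. w j *\<^sub>R (y j - p)) = 0"
    using assms by (simp add: scaleR_diff_right sum_subtractf flip: scaleR_sum_left)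
  ultimately show ?thesis
    using assms(1) by simp
qed

text \<open>With \<open>z\<close> a vertex, the parallel axis identity gives the squared distance
  \<open>c - R\<close>, where the moment \<open>R\<close> about \<open>p\<close> is the same for all
  vertices.\<close>

lemma equidistant_from_weighted_mean:
  fixes y :: "'i \<Rightarrow> 'b::real_inner"
  assumes "(\<Sum>j\<in>A. w j) = 1"
    and const: "\<And>i. i \<in> A \<Longrightarrow> (\<Sum>j\<in>A. w j * (norm (y i - y j))\<^sup>2) = c"
    and "i \<in> A"
  shows "(norm (y i - (\<Sum>j\<in>A. w j *\<^sub>R y j)))\<^sup>2 = c / 2"
proof -
  define p where "p = (\<Sum>j\<in>A. w j *\<^sub>R y j)"
  define R where "R = (\<Sum>j\<in>A. w j * (norm (y j - p))\<^sup>2)"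
  have dist: "(norm (y k - p))\<^sup>2 = c - R" if "k \<in> A" for k
    using parallel_axis[OF assms(1) p_def, of "y k"] const[OF that] by (simp add: R_def)
  \<comment> \<open>\<open>R\<close> is itself the weighted mean of these equal squared distances,
    so \<open>R = c - R\<close> and both are \<open>c / 2\<close>.\<close>
  have "R = (\<Sum>j\<in>A. w j) * (c - R)"
    unfolding sum_distrib_right by (subst R_def) (intro sum.cong refl, simp add: dist)
  then show ?thesis
    using assms(1) dist[OF assms(3)] by (simp add: p_def)
qed

theorem theorem5p4:
  fixes X :: "'a set" and d :: "'a \<Rightarrow> 'a \<Rightarrow> real"
    and x :: "'n::finite \<Rightarrow> 'a" and w :: "real ^ 'n"
    and S :: "'b::euclidean_space set" and y :: "'n \<Rightarrow> 'b"
  assumes "Metric_space X d" and "bij_betw x UNIV X"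
    and "negative_type d x"
    and "is_microscopic_weighting d x w"
    and "subspace S" and "dim S = CARD('n) - 1"
    and "\<And>i. y i \<in> S"
    and "\<And>i j. (norm (y i - y j))\<^sup>2 = d (x i) (x j)"
  shows "magnitude_function d x differentiable (at 0 within {0..}) \<and>
    (\<forall>i. y i \<in> sphere (\<Sum>j\<in>UNIV. w $ j *\<^sub>R y j)
       (sqrt (1 / 2 * vector_derivative (magnitude_function d x) (at 0 within {0..}))))"
proof -
  interpret Metric_space X d by fact
  have x: "x i \<in> X" "x i = x j \<longleftrightarrow> i = j" for i j
    using assms(2) by (auto simp: bij_betw_def inj_eq)
  have inv: "\<forall>\<^sub>F t in at_right 0. invertible (similarity_matrix d x t)"
    using x by (intro eventually_invertible_similarity_matrix) (auto intro: mdist_pos_less)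
  note deriv = magnitude_function_has_derivative_0[OF assms(4) inv]
  define c where "c = vector_derivative (magnitude_function d x) (at 0 within {0..})"
  \<comment> \<open>Nontriviality of the filter makes the one-sided derivative unique, so the values
    obtained from all rows \<open>i\<close> coincide with \<open>c\<close>.\<close>
  have "at (0::real) within {0..} \<noteq> bot"
    by (simp add: at_0_within_atLeast)
  then have c: "(\<Sum>j\<in>UNIV. w $ j * (norm (y i - y j))\<^sup>2) = c" for i
    using vector_derivative_within[OF _ deriv[of i, unfolded has_real_derivative_iff_has_vector_derivative]]
    by (simp add: c_def assms(8) mult.commute)
  have "(norm (y i - (\<Sum>j\<in>UNIV. w $ j *\<^sub>R y j)))\<^sup>2 = c / 2" for i
    using c by (intro equidistant_from_weighted_mean microscopic_weighting_sum[OF assms(4) inv]) auto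
  \<comment> \<open>No sign condition on \<open>c\<close> has to be checked: \<open>c / 2\<close> is
    the square of a norm.\<close>
  then have "norm (y i - (\<Sum>j\<in>UNIV. w $ j *\<^sub>R y j)) = sqrt (1 / 2 * c)" for i
    by (metis mult.left_neutral norm_ge_zero real_sqrt_unique times_divide_eq_left)
  then show ?thesis
    using deriv by (auto simp: c_def dist_norm norm_minus_commute
        intro: differentiableI_vector dest: has_real_derivative_iff_has_vector_derivative[THEN iffD1])
qed

end
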